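(* Fix a tree partition $\langle A_s\rangle$ of $\omega$ and a proper ideal $\mathcal J\supseteq\mathrm{Fin}$ on $\omega$. For every node $s\in\omega^{<\omega}$ and every $\alpha<\omega_1$, \[ \mathcal H^{\mathcal J}_{\alpha+1}(s)=\Bigl\{X\subseteq A_s:\{n\in\omega:X\cap A_{s^\frown n}\notin\mathcal H^{\mathcal J}_\alpha(s^\frown n)\}\in\mathcal J\Bigr\}, \] and for every limit ordinal $0<\lambda<\omega_1$, $\mathcal H^{\mathcal J}_\lambda(s)=\bigcup_{\beta<\lambda}\mathcal H^{\mathcal J}_\beta(s)$. Consequently, for all $m,n<\omega$ and $r\ge1$, \[ \mathcal H^{\mathcal J}_m\cong\underbrace{\mathcal J\otimes\cdots\otimes\mathcal J}_{m}\otimes\mathrm{Fin},\qquad \mathcal H^{\mathrm{Fin}^{\otimes r}}_m\cong\mathrm{Fin}^{\otimes(rm+1)},\qquad \mathcal H_n\cong\mathrm{Fin}^{\otimes(n+1)}. \]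
   Context: A tree partition of $\omega$ is a family $\langle A_s:s\in\omega^{<\omega}\rangle$ of infinite subsets of $\omega$ such that $A_\varnothing=\omega$, for each $s$ the family $\{A_{s^\frown n}:n\in\omega\}$ is a partition of $A_s$, and any two distinct points of $\omega$ lie in different cells $A_s\neq A_t$ with $|s|=|t|=n$ for some $n$. For $T\subseteq\omega^{<\omega}$ put $\mathrm{Succ}_T(s)=\{n:s^\frown n\in T\}$ and $D_{\mathcal J}(T)=\{s\in T:\mathrm{Succ}_T(s)\notin\mathcal J\}$; $D^0_{\mathcal J}(T)=T$, $D^{\alpha+1}_{\mathcal J}(T)=D_{\mathcal J}(D^\alpha_{\mathcal J}(T))$, $D^\lambda_{\mathcal J}(T)=\bigcap_{\beta<\lambda}D^\beta_{\mathcal J}(T)$ for limit $\lambda$. Localized ideals: for a node $s$, the family $\langle A_{s^\frown u}:u\in\omega^{<\omega}\rangle$ is a tree partition of $A_s$, and $\mathcal H^{\mathcal J}_\alpha(s)=\{X\subseteq A_s:\varnothing\notin D^\alpha_{\mathcal J}(\{u\in\omega^{<\omega}:X\cap A_{s^\frown u}\text{ is infinite}\})\}$. Write $\mathcal H^{\mathcal J}_\alpha=\mathcal H^{\mathcal J}_\alpha(\varnothing)$ and $\mathcal H_\alpha=\mathcal H^{\mathrm{Fin}}_\alpha$. $\mathrm{Fin}$ is the ideal of finite subsets of $\omega$. For ideals $\mathcal I$ on $S$ and $\mathcal K$ on $T$, $\mathcal I\otimes\mathcal K=\{C\subseteq S\times T:\{x:\{y:(x,y)\in C\}\notin\mathcal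 K\}\in\mathcal I\}$; $\mathrm{Fin}^{\otimes r}$ is the $r$-fold product of $\mathrm{Fin}$ (an ideal on $\omega^r$, transported to $\omega$ by a bijection when used as the auxiliary ideal $\mathcal J$). $\mathcal I\cong\mathcal K$ means there is a bijection of the underlying sets carrying $\mathcal I$ onto $\mathcal K$. For $m=0$ the first product is just $\mathrm{Fin}$. *)

theory Defs
  imports "HOL-Library.Countable_Set" "HOL-Library.Disjoint_Sets"
begin

section \<open>The countable ordinals\<close>

text \<open>
  \<^term>\<open>cardSuc natLeq\<close> is the cardinal successor of \<^term>\<open>natLeq\<close>, realised as a well-order
  on a set of sets of naturals. Its order type is \<open>\<omega>\<^sub>1\<close>, so the elements of \<open>omega1\<close> are exactly the
  ordinals \<open>\<alpha> < \<omega>\<^sub>1\<close>; the lemmas \<open>countable_omega1_segment\<close> and \<open>uncountable_omega1\<close> confirm this.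
\<close>

typedef omega1 = "Field (cardSuc natLeq)"
proof -
  have "infinite (Field (cardSuc natLeq))"
    using cardSuc_finite[OF natLeq_Card_order] by (simp add: Field_natLeq)
  then show ?thesis
    by (metis finite.emptyI ex_in_conv)
qed

instantiation omega1 :: wellorder
begin

definition less_eq_omega1 :: "omega1 \<Rightarrow> omega1 \<Rightarrow> bool" where
  "\<alpha> \<le> \<beta> \<longleftrightarrow> (Rep_omega1 \<alpha>, Rep_omega1 \<beta>) \<in> cardSuc natLeq"

definition less_omega1 :: "omega1 \<Rightarrow> omega1 \<Rightarrow> bool" where
  "\<alpha> < \<beta> \<longleftrightarrow> \<alpha> \<le> \<beta> \<and> \<not> \<beta> \<le> (\<alpha>::omega1)"

instance
proof -
  let ?r = "cardSuc natLeq"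
  have wo: "Well_order ?r"
    using cardSuc_Card_order[OF natLeq_Card_order] card_order_on_well_order_on by blast
  then have lin: "linear_order_on (Field ?r) ?r" and wf: "wf (?r - Id)"
    by (auto simp: well_order_on_def)
  then have refl: "refl_on (Field ?r) ?r" and tr: "trans ?r" and anti: "antisym ?r"
    and tot: "total_on (Field ?r) ?r"
    by (auto simp: linear_order_on_def partial_order_on_def preorder_on_def)
  have le_refl: "\<alpha> \<le> \<alpha>" for \<alpha> :: omega1
    using refl Rep_omega1[of \<alpha>] by (auto simp: less_eq_omega1_def refl_on_def)
  have le_tot: "\<alpha> \<le> \<beta> \<or> \<beta> \<le> \<alpha>" for \<alpha> \<beta> :: omega1
    using tot Rep_omega1[of \<alpha>] Rep_omega1[of \<beta>] le_refl[of \<alpha>]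
    by (cases "Rep_omega1 \<alpha> = Rep_omega1 \<beta>") (auto simp: less_eq_omega1_def total_on_def)
  have le_anti: "\<alpha> = \<beta>" if "\<alpha> \<le> \<beta>" "\<beta> \<le> \<alpha>" for \<alpha> \<beta> :: omega1
    using that antisymD[OF anti] by (simp add: less_eq_omega1_def flip: Rep_omega1_inject)
  have le_tr: "\<alpha> \<le> \<gamma>" if "\<alpha> \<le> \<beta>" "\<beta> \<le> \<gamma>" for \<alpha> \<beta> \<gamma> :: omega1
    using that tr unfolding less_eq_omega1_def trans_def by blast
  have sub: "{(\<alpha>, \<beta>::omega1). \<alpha> < \<beta>} \<subseteq> inv_image (?r - Id) Rep_omega1"
    using le_refl by (auto simp: less_omega1_def less_eq_omega1_def)
  have wf': "wf {(\<alpha>, \<beta>::omega1). \<alpha> < \<beta>}"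
    by (rule wf_subset[OF wf_inv_image[OF wf] sub])
  show "OFCLASS(omega1, wellorder_class)"
  proof (standard, goal_cases)
    case 1
    show ?case by (rule less_omega1_def)
  next
    case 2
    show ?case by (rule le_refl)
  next
    case 3
    then show ?case by (rule le_tr)
  next
    case 4
    then show ?case by (rule le_anti)
  next
    case 5
    show ?case by (rule le_tot)
  next
    case (6 P a)
    then show ?case using wf_induct_rule[OF wf', of P a] by blast
  qed
qed

end

instantiation omega1 :: zero
begin
definition zero_omega1 :: omega1 where "0 = (LEAST \<alpha>::omega1. True)"
instance ..
end

lemma zero_le_omega1: "(0::omega1) \<le> \<alpha>"
  unfolding zero_omega1_def by (rule Least_le) simp

definition osuc :: "omega1 \<Rightarrow> omega1" where
  "osuc \<alpha> = (LEAST \<beta>. \<alpha> < \<beta>)"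

definition is_limit :: "omega1 \<Rightarrow> bool" where
  "is_limit \<delta> \<longleftrightarrow> \<delta> \<noteq> 0 \<and> (\<forall>\<beta>. \<delta> \<noteq> osuc \<beta>)"

definition fin_ord :: "nat \<Rightarrow> omega1" where
  "fin_ord n = (osuc ^^ n) 0"

lemma less_osuc: "\<alpha> < osuc \<alpha>"
proof -
  let ?r = "cardSuc natLeq"
  have inf: "infinite (Field ?r)"
    using cardSuc_finite[OF natLeq_Card_order] by (simp add: Field_natLeq)
  obtain b where "b \<in> Field ?r" "Rep_omega1 \<alpha> \<noteq> b" "(Rep_omega1 \<alpha>, b) \<in> ?r"
    using infinite_Card_order_limit[OF cardSuc_Card_order[OF natLeq_Card_order] inf Rep_omega1] by blast
  then have "\<alpha> \<le> Abs_omega1 b" "\<alpha> \<noteq> Abs_omega1 b"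
    by (auto simp: less_eq_omega1_def Abs_omega1_inverse)
  then have "\<alpha> < Abs_omega1 b" by simp
  then show ?thesis unfolding osuc_def by (rule LeastI)
qed

lemma osuc_le_iff: "osuc \<alpha> \<le> \<beta> \<longleftrightarrow> \<alpha> < \<beta>"
  using less_osuc[of \<alpha>] Least_le[of "\<lambda>\<beta>. \<alpha> < \<beta>" \<beta>] unfolding osuc_def[symmetric] by fastforce

lemma osuc_inject: "osuc \<alpha> = osuc \<beta> \<longleftrightarrow> \<alpha> = \<beta>"
  by (metis less_osuc osuc_le_iff leD not_less_iff_gr_or_eq order_refl)

lemma osuc_neq_zero: "osuc \<alpha> \<noteq> 0"
  by (metis less_osuc zero_le_omega1 leD)

lemma countable_omega1_segment: "countable {\<beta>::omega1. \<beta> < \<alpha>}"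
proof -
  include cardinal_syntax
  let ?r = "cardSuc natLeq"
  have co: "Card_order ?r" by (rule cardSuc_Card_order[OF natLeq_Card_order])
  have "|underS ?r (Rep_omega1 \<alpha>)| <o ?r"
    by (rule card_of_underS[OF co Rep_omega1])
  then have "|underS ?r (Rep_omega1 \<alpha>)| \<le>o natLeq"
    using cardSuc_ordLeq_ordLess[OF natLeq_Card_order card_of_Card_order] by blast
  then have "|underS ?r (Rep_omega1 \<alpha>)| \<le>o |UNIV :: nat set|"
    using card_of_nat ordIso_symmetric ordLeq_ordIso_trans by blast
  then have "countable (underS ?r (Rep_omega1 \<alpha>))"
    by (auto simp: countable_def card_of_ordLeq[symmetric])
  moreover have "Rep_omega1 ` {\<beta>. \<beta> < \<alpha>} \<subseteq> underS ?r (Rep_omega1 \<alpha>)"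
    by (auto simp: underS_def less_omega1_def less_eq_omega1_def Rep_omega1_inject)
  ultimately have "countable (Rep_omega1 ` {\<beta>. \<beta> < \<alpha>})"
    using countable_subset by blast
  then show ?thesis
    by (rule countable_image_inj_on) (simp add: inj_on_def Rep_omega1_inject)
qed

lemma uncountable_omega1: "uncountable (UNIV :: omega1 set)"
proof
  include cardinal_syntax
  let ?r = "cardSuc natLeq"
  assume "countable (UNIV :: omega1 set)"
  then have "countable (range Rep_omega1)" by (rule countable_image)
  then have "countable (Field ?r)"
    by (simp add: type_definition.Rep_range[OF type_definition_omega1])
  then have "|Field ?r| \<le>o |UNIV :: nat set|"
    by (auto simp: countable_def card_of_ordLeq[symmetric])
  then have "?r \<le>o natLeq"
    using card_of_nat card_of_Field_ordIso[OF cardSuc_Card_order[OF natLeq_Card_order]]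
      ordIso_symmetric ordLeq_ordIso_trans ordIso_ordLeq_trans by blast
  then show False
    using cardSuc_greater[OF natLeq_Card_order] not_ordLess_ordLeq by blast
qed


section \<open>Ideals, products and isomorphism\<close>

definition ideal_on :: "'a set \<Rightarrow> 'a set set \<Rightarrow> bool" where
  "ideal_on S \<I> \<longleftrightarrow> \<I> \<subseteq> Pow S \<and> {} \<in> \<I> \<and>
     (\<forall>X\<in>\<I>. \<forall>Y\<subseteq>X. Y \<in> \<I>) \<and> (\<forall>X\<in>\<I>. \<forall>Y\<in>\<I>. X \<union> Y \<in> \<I>)"

definition proper_ideal_on :: "'a set \<Rightarrow> 'a set set \<Rightarrow> bool" where
  "proper_ideal_on S \<I> \<longleftrightarrow> ideal_on S \<I> \<and> S \<notin> \<I>"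

definition Fin :: "nat set set" where
  "Fin = {X. finite X}"

definition ideal_prod :: "'a set \<Rightarrow> 'b set \<Rightarrow> 'a set set \<Rightarrow> 'b set set \<Rightarrow> ('a \<times> 'b) set set" where
  "ideal_prod S T \<I> \<K> = {C. C \<subseteq> S \<times> T \<and> {x\<in>S. {y\<in>T. (x, y) \<in> C} \<notin> \<K>} \<in> \<I>}"

definition ideal_iso :: "'a set \<Rightarrow> 'a set set \<Rightarrow> 'b set \<Rightarrow> 'b set set \<Rightarrow> bool" where
  "ideal_iso S \<I> T \<K> \<longleftrightarrow> (\<exists>f. bij_betw f S T \<and> (`) f ` \<I> = \<K>)"

text \<open>\<open>tuples r\<close> is \<open>\<omega>\<^sup>r\<close>, encoded by lists of length \<open>r\<close>.\<close>

definition tuples :: "nat \<Rightarrow> nat list set" where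
  "tuples r = {xs. length xs = r}"

text \<open>
  \<open>iter_prod \<J> m \<K>\<close> is \<open>\<J> \<otimes> (\<J> \<otimes> \<dots> (\<J> \<otimes> \<K>))\<close> with \<open>m\<close> factors \<open>\<J>\<close>, as an ideal on \<open>\<omega>\<^sup>m\<^sup>+\<^sup>1\<close>:
  the product on \<open>\<omega> \<times> \<omega>\<^sup>m\<close> is carried to \<open>\<omega>\<^sup>m\<^sup>+\<^sup>1\<close> by prepending the first coordinate.
\<close>

fun iter_prod :: "nat set set \<Rightarrow> nat \<Rightarrow> nat set set \<Rightarrow> nat list set set" where
  "iter_prod \<J> 0 \<K> = (`) (\<lambda>n. [n]) ` \<K>"
| "iter_prod \<J> (Suc m) \<K> =
     (`) (\<lambda>(n, xs). n # xs) ` ideal_prod UNIV (tuples (Suc m)) \<J> (iter_prod \<J> m \<K>)"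

text \<open>The \<open>r\<close>-fold product \<open>Fin\<^sup>\<otimes>\<^sup>r\<close> on \<^term>\<open>tuples r\<close>; only meaningful for \<open>r \<ge> 1\<close>.\<close>

definition Fin_pow :: "nat \<Rightarrow> nat list set set" where
  "Fin_pow r = iter_prod Fin (r - 1) Fin"


section \<open>Tree partitions, derivatives and localized ideals\<close>

text \<open>
  Nodes in \<open>\<omega>\<^sup><\<^sup>\<omega>\<close> are lists. The partition of \<open>A s\<close> is an indexed one: cells with
  distinct indices are disjoint.
\<close>

definition tree_partition :: "(nat list \<Rightarrow> nat set) \<Rightarrow> bool" where
  "tree_partition A \<longleftrightarrow>
     (\<forall>s. infinite (A s)) \<and> A [] = UNIV \<and>
     (\<forall>s. disjoint_family (\<lambda>n. A (s @ [n])) \<and> (\<Union>n. A (s @ [n])) = A s) \<and>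
     (\<forall>x y. x \<noteq> y \<longrightarrow> (\<exists>s t. length s = length t \<and> x \<in> A s \<and> y \<in> A t \<and> A s \<noteq> A t))"

definition Succ :: "nat list set \<Rightarrow> nat list \<Rightarrow> nat set" where
  "Succ T s = {n. s @ [n] \<in> T}"

definition tree_deriv :: "nat set set \<Rightarrow> nat list set \<Rightarrow> nat list set" where
  "tree_deriv \<J> T = {s \<in> T. Succ T s \<notin> \<J>}"

function tree_deriv_iter :: "nat set set \<Rightarrow> omega1 \<Rightarrow> nat list set \<Rightarrow> nat list set" where
  "tree_deriv_iter \<J> \<alpha> T =
     (if \<alpha> = 0 then T
      else if \<exists>\<beta>. \<alpha> = osuc \<beta> then tree_deriv \<J> (tree_deriv_iter \<J> (THE \<beta>. \<alpha> = osuc \<beta>) T)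
      else (\<Inter>\<beta>\<in>{..<\<alpha>}. tree_deriv_iter \<J> \<beta> T))"
  by pat_completeness auto
termination
proof (relation "inv_image {(\<alpha>, \<beta>). \<alpha> < \<beta>} (fst \<circ> snd)", goal_cases)
  case 1
  show ?case by (intro wf_inv_image wf)
next
  case (2 \<J> \<alpha> T)
  then show ?case by (auto simp: osuc_inject less_osuc)
next
  case (3 \<J> \<alpha> T \<beta>)
  then show ?case by simp
qed

declare tree_deriv_iter.simps [simp del]

lemma tree_deriv_iter_0: "tree_deriv_iter \<J> 0 T = T"
  by (simp add: tree_deriv_iter.simps)

lemma tree_deriv_iter_osuc: "tree_deriv_iter \<J> (osuc \<alpha>) T = tree_deriv \<J> (tree_deriv_iter \<J> \<alpha> T)"
  by (subst tree_deriv_iter.simps) (simp add: osuc_inject osuc_neq_zero)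

lemma tree_deriv_iter_limit:
  "is_limit \<delta> \<Longrightarrow> tree_deriv_iter \<J> \<delta> T = (\<Inter>\<beta>\<in>{..<\<delta>}. tree_deriv_iter \<J> \<beta> T)"
  by (subst tree_deriv_iter.simps) (auto simp: is_limit_def)

definition H_ideal ::
  "(nat list \<Rightarrow> nat set) \<Rightarrow> nat set set \<Rightarrow> omega1 \<Rightarrow> nat list \<Rightarrow> nat set set" where
  "H_ideal A \<J> \<alpha> s = {X. X \<subseteq> A s \<and> [] \<notin> tree_deriv_iter \<J> \<alpha> {u. infinite (X \<inter> A (s @ u))}}"

end

theory Submission
  imports Defs
begin

text \<open>
  The recursion for \<open>\<H>\<^sub>\<alpha>\<close> rests on two properties of the derivative. It is local: passing to the
  subtree above a node commutes with every iterate of the derivative (\<open>tree_deriv_iter_subtree\<close>), so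
  the condition that \<open>\<langle>n\<rangle>\<close> survives \<open>\<alpha>\<close> steps in the tree of \<open>X\<close> says precisely that
  \<open>X \<inter> A\<^bsub>s n\<^esub>\<close> lies outside \<open>\<H>\<^sub>\<alpha>(s n)\<close>. Moreover, in a tree the root survives as long as
  \<open>\<J>\<close>-positively many of its children do (\<open>root_in_tree_deriv_iter\<close>), so that the clause
  \<open>\<emptyset> \<in> D\<^sup>\<alpha>(T)\<close> hidden in \<open>\<emptyset> \<in> D\<^bsup>\<alpha>+1\<^esup>(T)\<close> follows from the clause about the children. The limit
  case is the definition of \<open>D\<^sup>\<lambda>\<close> as an intersection.

  The recursion exhibits \<open>\<H>\<^bsub>\<alpha>+1\<^esub>(s)\<close> as the Fubini sum over \<open>\<J>\<close> of the ideals
  \<open>\<H>\<^sub>\<alpha>(s n)\<close> on the disjoint cells \<open>A\<^bsub>s n\<^esub>\<close>. Isomorphisms of summands glue to an isomorphism of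
  Fubini sums (\<open>ideal_iso_ideal_sum\<close>). As \<open>\<H>\<^sub>0(s)\<close> is a copy of \<open>Fin\<close> on the infinite set
  \<open>A\<^sub>s\<close>, induction on \<open>m\<close>, carried out for all nodes at once, shows that \<open>\<H>\<^sub>m(s)\<close> is isomorphic to
  any ideal obtained from a copy of \<open>Fin\<close> by \<open>m\<close> times forming the sum over \<open>\<J>\<close> of copies of what has
  been reached (\<open>H_ideal_iso_iterated_sum\<close>). Products are such sums: one factor \<open>\<J>\<close> adds one coordinate,
  while a sum over \<open>Fin\<^bsup>\<otimes>r\<^esup>\<close> adds \<open>r\<close> coordinates at a time, by associativity of the product
  (\<open>mem_iter_prod_append\<close>).
\<close>

section \<open>Derivatives of trees\<close>

lemma ord_cases:
  obtains "\<alpha> = 0" | \<beta> where "\<alpha> = osuc \<beta>" | "is_limit \<alpha>"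
  by (metis is_limit_def)

lemma tree_deriv_iter_subtree:
  "u \<in> tree_deriv_iter \<J> \<alpha> {u. s @ u \<in> T} \<longleftrightarrow> s @ u \<in> tree_deriv_iter \<J> \<alpha> T"
proof (induction \<alpha> arbitrary: u rule: less_induct)
  case (less \<alpha>)
  show ?case
  proof (cases \<alpha> rule: ord_cases)
    case 1
    then show ?thesis by (simp add: tree_deriv_iter_0)
  next
    case (2 \<beta>)
    then show ?thesis
      using less[of \<beta>] by (simp add: tree_deriv_iter_osuc tree_deriv_def Succ_def less_osuc)
  next
    case 3
    then show ?thesis using less by (simp add: tree_deriv_iter_limit)
  qed
qed

text \<open>
  The derivatives decrease, so the hypothesis at a successor \<open>\<beta> + 1\<close> already gives
  \<open>\<J>\<close>-positively many surviving children at stage \<open>\<beta>\<close>, and the root survives the step from \<open>\<beta>\<close> to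
  \<open>\<beta> + 1\<close>.
\<close>

lemma root_in_tree_deriv_iter:
  assumes \<J>: "ideal_on UNIV \<J>"
    and closed: "\<And>n. [n] \<in> T \<Longrightarrow> [] \<in> T"
    and pos: "{n. [n] \<in> tree_deriv_iter \<J> \<alpha> T} \<notin> \<J>"
  shows "[] \<in> tree_deriv_iter \<J> \<alpha> T"
  using pos
proof (induction \<alpha> rule: less_induct)
  case (less \<alpha>)
  have smaller: "{n. [n] \<in> tree_deriv_iter \<J> \<beta> T} \<notin> \<J>"
    if "tree_deriv_iter \<J> \<alpha> T \<subseteq> tree_deriv_iter \<J> \<beta> T" for \<beta>
  proof -
    have "{n. [n] \<in> tree_deriv_iter \<J> \<alpha> T} \<subseteq> {n. [n] \<in> tree_deriv_iter \<J> \<beta> T}"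
      using that by blast
    then show ?thesis
      using less.prems \<J> unfolding ideal_on_def by blast
  qed
  show ?case
  proof (cases \<alpha> rule: ord_cases)
    case 1
    have "{n. [n] \<in> T} \<noteq> {}"
      using less.prems \<J> 1 by (metis ideal_on_def tree_deriv_iter_0)
    then show ?thesis using closed 1 by (auto simp: tree_deriv_iter_0)
  next
    case (2 \<beta>)
    have pos: "{n. [n] \<in> tree_deriv_iter \<J> \<beta> T} \<notin> \<J>"
      by (rule smaller) (auto simp: 2 tree_deriv_iter_osuc tree_deriv_def)
    then have "[] \<in> tree_deriv_iter \<J> \<beta> T"
      using less.IH 2 less_osuc by blast
    then show ?thesis
      using pos by (simp add: 2 tree_deriv_iter_osuc tree_deriv_def Succ_def)
  next
    case 3
    have "[] \<in> tree_deriv_iter \<J> \<beta> T" if "\<beta> < \<alpha>" for \<beta>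
    proof (rule less.IH[OF that smaller])
      show "tree_deriv_iter \<J> \<alpha> T \<subseteq> tree_deriv_iter \<J> \<beta> T"
        using 3 that by (auto simp: tree_deriv_iter_limit)
    qed
    then show ?thesis using 3 by (simp add: tree_deriv_iter_limit)
  qed
qed

section \<open>The recursion for the localized ideals\<close>

lemma tree_partition_append_subset:
  assumes "tree_partition A"
  shows "A (s @ u) \<subseteq> A s"
proof (induction u rule: rev_induct)
  case Nil
  show ?case by simp
next
  case (snoc n u)
  have "A ((s @ u) @ [n]) \<subseteq> A (s @ u)"
    using assms unfolding tree_partition_def by blast
  then show ?case using snoc by simp
qed

lemma H_ideal_0:
  assumes "tree_partition A"
  shows "H_ideal A \<J> 0 s = {X. X \<subseteq> A s \<and> finite X}"
  by (auto simp: H_ideal_def tree_deriv_iter_0 Int_absorb2)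

lemma H_ideal_osuc:
  assumes A: "tree_partition A" and \<J>: "ideal_on UNIV \<J>"
  shows "H_ideal A \<J> (osuc \<alpha>) s =
    {X. X \<subseteq> A s \<and> {n. X \<inter> A (s @ [n]) \<notin> H_ideal A \<J> \<alpha> (s @ [n])} \<in> \<J>}"
proof -
  have "[] \<in> tree_deriv_iter \<J> (osuc \<alpha>) {u. infinite (X \<inter> A (s @ u))}
      \<longleftrightarrow> {n. X \<inter> A (s @ [n]) \<notin> H_ideal A \<J> \<alpha> (s @ [n])} \<notin> \<J>" for X
  proof -
    define T where "T = {u. infinite (X \<inter> A (s @ u))}"
    have "A (s @ [n] @ u) \<subseteq> A (s @ [n])" for n u
      using tree_partition_append_subset[OF A, of "s @ [n]" u] by simp
    then have "X \<inter> A (s @ [n]) \<inter> A (s @ [n] @ u) = X \<inter> A (s @ [n] @ u)" for n u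
      by blast
    then have "{u. infinite (X \<inter> A (s @ [n]) \<inter> A ((s @ [n]) @ u))} = {u. [n] @ u \<in> T}" for n
      by (simp add: T_def)
    then have child: "X \<inter> A (s @ [n]) \<notin> H_ideal A \<J> \<alpha> (s @ [n])
        \<longleftrightarrow> [n] \<in> tree_deriv_iter \<J> \<alpha> T" for n
      using tree_deriv_iter_subtree[of "[]" \<J> \<alpha> "[n]" T] by (simp add: H_ideal_def)
    have "[] \<in> T" if "[n] \<in> T" for n
      using that tree_partition_append_subset[OF A, of s "[n]"]
      unfolding T_def by (auto intro: finite_subset[of _ "X \<inter> A s"])
    then have "[] \<in> tree_deriv_iter \<J> \<alpha> T" if "{n. [n] \<in> tree_deriv_iter \<J> \<alpha> T} \<notin> \<J>"
      using root_in_tree_deriv_iter[OF \<J> _ that] by blast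
    then show ?thesis
      unfolding child by (auto simp: tree_deriv_iter_osuc tree_deriv_def Succ_def simp flip: T_def)
  qed
  then show ?thesis unfolding H_ideal_def[of A \<J> "osuc \<alpha>"] by blast
qed

lemma H_ideal_limit:
  assumes "is_limit \<delta>"
  shows "H_ideal A \<J> \<delta> s = (\<Union>\<beta>\<in>{..<\<delta>}. H_ideal A \<J> \<beta> s)"
  using assms by (auto simp: H_ideal_def tree_deriv_iter_limit)

section \<open>Fubini sums of ideals\<close>

definition ideal_sum :: "nat set set \<Rightarrow> (nat \<Rightarrow> 'a set) \<Rightarrow> (nat \<Rightarrow> 'a set set) \<Rightarrow> 'a set set" where
  "ideal_sum \<J> B \<I> = {X. X \<subseteq> (\<Union>n. B n) \<and> {n. X \<inter> B n \<notin> \<I> n} \<in> \<J>}"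

lemma ideal_isoI:
  assumes f: "bij_betw f S T" and "\<I> \<subseteq> Pow S" and \<K>: "\<K> \<subseteq> Pow T"
    and iff: "\<And>X. X \<subseteq> S \<Longrightarrow> f ` X \<in> \<K> \<longleftrightarrow> X \<in> \<I>"
  shows "ideal_iso S \<I> T \<K>"
proof -
  have "Y \<in> (`) f ` \<I>" if "Y \<in> \<K>" for Y
  proof -
    have "Y \<subseteq> f ` S"
      using that \<K> f by (auto simp: bij_betw_def)
    then obtain X where X: "X \<subseteq> S" "Y = f ` X"
      by (rule subset_imageE)
    then have "X \<in> \<I>" using iff that by blast
    then show ?thesis using X(2) by (rule rev_image_eqI)
  qed
  moreover have "f ` X \<in> \<K>" if "X \<in> \<I>" for X
    using that assms(2) iff by blast
  ultimately have "(`) f ` \<I> = \<K>"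
    by (intro equalityI subsetI) auto
  then show ?thesis using f unfolding ideal_iso_def by blast
qed

lemma ideal_isoE:
  assumes "ideal_iso S \<I> T \<K>" and "\<I> \<subseteq> Pow S"
  obtains f where "bij_betw f S T" and "\<And>X. X \<subseteq> S \<Longrightarrow> f ` X \<in> \<K> \<longleftrightarrow> X \<in> \<I>"
proof -
  obtain f where f: "bij_betw f S T" and \<K>: "(`) f ` \<I> = \<K>"
    using assms(1) unfolding ideal_iso_def by blast
  have "X \<in> \<I>" if "X \<subseteq> S" "Y \<in> \<I>" "f ` X = f ` Y" for X Y
  proof -
    have "Y \<subseteq> S" using that(2) assms(2) by blast
    then have "X = Y"
      using that(1,3) inj_on_image_eq_iff[OF bij_betw_imp_inj_on[OF f]] by simp
    then show ?thesis using that(2) by simp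
  qed
  then have "f ` X \<in> \<K> \<longleftrightarrow> X \<in> \<I>" if "X \<subseteq> S" for X
    using that unfolding \<K>[symmetric] by auto
  then show thesis using that f by blast
qed

lemma ideal_iso_trans:
  assumes "ideal_iso S \<I> T \<K>" and "ideal_iso T \<K> U \<L>"
  shows "ideal_iso S \<I> U \<L>"
proof -
  obtain f g where f: "bij_betw f S T" "(`) f ` \<I> = \<K>" and g: "bij_betw g T U" "(`) g ` \<K> = \<L>"
    using assms unfolding ideal_iso_def by blast
  have "(`) (g \<circ> f) ` \<I> = \<L>"
    using f(2) g(2) by (auto simp: image_image)
  then show ?thesis
    unfolding ideal_iso_def using bij_betw_trans[OF f(1) g(1)] by blast
qed

text \<open>
  Since the blocks are disjoint, the bijections of the blocks combine to one bijection \<open>h\<close> of the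
  unions. It maps the trace of \<open>X\<close> on \<open>B n\<close> onto the trace of \<open>h ` X\<close> on \<open>C n\<close>, so for both sums
  the set of indices to be tested against \<open>\<J>\<close> is the same.
\<close>

lemma ideal_iso_ideal_sum:
  assumes B: "disjoint_family B" and C: "disjoint_family C"
    and \<I>: "\<And>n. \<I> n \<subseteq> Pow (B n)"
    and iso: "\<And>n. ideal_iso (B n) (\<I> n) (C n) (\<K> n)"
  shows "ideal_iso (\<Union>n. B n) (ideal_sum \<J> B \<I>) (\<Union>n. C n) (ideal_sum \<J> C \<K>)"
proof -
  have "\<exists>f. bij_betw f (B n) (C n) \<and> (\<forall>X\<subseteq>B n. f ` X \<in> \<K> n \<longleftrightarrow> X \<in> \<I> n)" for n
    using ideal_isoE[OF iso \<I>] by metis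
  then obtain f where f: "\<And>n. bij_betw (f n) (B n) (C n)"
    and f_iff: "\<And>n X. X \<subseteq> B n \<Longrightarrow> f n ` X \<in> \<K> n \<longleftrightarrow> X \<in> \<I> n"
    by metis
  define h where "h x = f (THE n. x \<in> B n) x" for x
  have h: "h x = f n x" if "x \<in> B n" for x n
  proof -
    have "(THE n. x \<in> B n) = n"
      using that B by (intro the_equality) (auto simp: disjoint_family_on_def)
    then show ?thesis by (simp add: h_def)
  qed
  have h_C: "h x \<in> C n \<longleftrightarrow> x \<in> B n" if x: "x \<in> (\<Union>n. B n)" for x n
  proof -
    obtain k where k: "x \<in> B k" using x by blast
    then have "h x \<in> C k" using h f by (metis bij_betwE)
    then have "h x \<in> C n \<longleftrightarrow> n = k" "x \<in> B n \<longleftrightarrow> n = k"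
      using B C k unfolding disjoint_family_on_def by blast+
    then show ?thesis by simp
  qed
  have "bij_betw h (\<Union>n. B n) (\<Union>n. C n)"
  proof (rule bij_betw_imageI)
    show "inj_on h (\<Union>n. B n)"
    proof (rule inj_onI)
      fix x y
      assume xy: "x \<in> (\<Union>n. B n)" "y \<in> (\<Union>n. B n)" "h x = h y"
      then obtain n where "x \<in> B n" by blast
      moreover from this have "y \<in> B n" using xy h_C by metis
      ultimately show "x = y"
        using h f xy(3) by (metis bij_betw_imp_inj_on inj_onD)
    qed
    have "h ` B n = C n" for n
      using f[of n] h by (metis bij_betw_imp_surj_on image_cong)
    then show "h ` (\<Union>n. B n) = (\<Union>n. C n)" by (simp add: image_UN)
  qed
  then show ?thesis
  proof (rule ideal_isoI)
    fix X
    assume X: "X \<subseteq> (\<Union>n. B n)"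
    have "h ` X \<inter> C n = f n ` (X \<inter> B n)" for n
      using X h_C h by (force simp: image_iff)
    then have "h ` X \<inter> C n \<in> \<K> n \<longleftrightarrow> X \<inter> B n \<in> \<I> n" for n
      by (simp add: f_iff)
    moreover have "h ` X \<subseteq> (\<Union>n. C n)"
      using X h_C by blast
    ultimately show "h ` X \<in> ideal_sum \<J> C \<K> \<longleftrightarrow> X \<in> ideal_sum \<J> B \<I>"
      using X by (simp add: ideal_sum_def)
  qed (auto simp: ideal_sum_def)
qed

text \<open>
  For a sum of copies of a single ideal, the traces on the blocks can be pulled back to the model
  \<open>T\<close>; this is the shape in which products are defined.
\<close>

lemma ideal_sum_copies:
  assumes inj: "\<And>n. inj_on (g n) T" and \<K>: "\<K> \<subseteq> Pow T"
  shows "ideal_sum \<J> (\<lambda>n. g n ` T) (\<lambda>n. (`) (g n) ` \<K>)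
    = {X. X \<subseteq> (\<Union>n. g n ` T) \<and> {n. {y \<in> T. g n y \<in> X} \<notin> \<K>} \<in> \<J>}"
proof -
  have "X \<inter> g n ` T \<in> (`) (g n) ` \<K> \<longleftrightarrow> {y \<in> T. g n y \<in> X} \<in> \<K>" for X n
  proof -
    have eq: "X \<inter> g n ` T = g n ` {y \<in> T. g n y \<in> X}" by blast
    have "{y \<in> T. g n y \<in> X} = Y" if "Y \<in> \<K>" "g n ` {y \<in> T. g n y \<in> X} = g n ` Y" for Y
    proof -
      have "Y \<subseteq> T" using that(1) \<K> by blast
      then show ?thesis
        using that(2) inj_on_image_eq_iff[OF inj, of "{y \<in> T. g n y \<in> X}" Y n] by simp
    qed
    then show ?thesis unfolding eq by auto
  qed
  then show ?thesis by (simp add: ideal_sum_def)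
qed

text \<open>
  The ideals \<open>\<K> m\<close> satisfy the recursion of \<open>\<H>\<^sub>m\<close>, with the cells below a node replaced by the
  disjoint copies of \<open>T m\<close> under the maps \<open>g n\<close>. Leaving \<open>g\<close> open covers both prepending a number
  and prepending a tuple. The induction treats all nodes at once, as the step at \<open>s\<close> uses the isomorphisms at all its
  children.
\<close>

lemma H_ideal_iso_iterated_sum:
  fixes T :: "nat \<Rightarrow> 'a set" and g :: "nat \<Rightarrow> 'a \<Rightarrow> 'a"
  assumes A: "tree_partition A" and \<J>: "ideal_on UNIV \<J>"
    and inj: "\<And>m n. inj_on (g n) (T m)"
    and disj: "\<And>m. disjoint_family (\<lambda>n. g n ` T m)"
    and T: "\<And>m. T (Suc m) = (\<Union>n. g n ` T m)"
    and \<K>: "\<And>m. \<K> (Suc m) = ideal_sum \<J> (\<lambda>n. g n ` T m) (\<lambda>n. (`) (g n) ` \<K> m)"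
    and base: "ideal_iso UNIV Fin (T 0) (\<K> 0)"
  shows "ideal_iso (A s) (H_ideal A \<J> (fin_ord m) s) (T m) (\<K> m)"
proof (induction m arbitrary: s)
  case 0
  have inf: "infinite (A s)"
    using A by (simp add: tree_partition_def)
  have "ideal_iso (A s) (H_ideal A \<J> 0 s) UNIV Fin"
  proof (rule ideal_isoI)
    show bij: "bij_betw (to_nat_on (A s)) (A s) UNIV"
      using inf by (simp add: to_nat_on_infinite)
    show "to_nat_on (A s) ` X \<in> Fin \<longleftrightarrow> X \<in> H_ideal A \<J> 0 s" if "X \<subseteq> A s" for X
      using that bij inj_on_subset[OF bij_betw_imp_inj_on[OF bij] that]
      by (simp add: Fin_def H_ideal_0[OF A] finite_image_iff)
  qed (auto simp: H_ideal_def)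
  then show ?case
    using base ideal_iso_trans by (auto simp: fin_ord_def)
next
  case (Suc m)
  have cells: "disjoint_family (\<lambda>n. A (s @ [n]))" "(\<Union>n. A (s @ [n])) = A s"
    using A by (auto simp: tree_partition_def)
  have H: "H_ideal A \<J> (fin_ord (Suc m)) s
      = ideal_sum \<J> (\<lambda>n. A (s @ [n])) (\<lambda>n. H_ideal A \<J> (fin_ord m) (s @ [n]))"
    using cells(2) by (simp add: fin_ord_def H_ideal_osuc[OF A \<J>] ideal_sum_def)
  have "ideal_iso (T m) (\<K> m) (g n ` T m) ((`) (g n) ` \<K> m)" for n
    using inj[of n m] unfolding ideal_iso_def bij_betw_def by blast
  then have "ideal_iso (A (s @ [n])) (H_ideal A \<J> (fin_ord m) (s @ [n]))
      (g n ` T m) ((`) (g n) ` \<K> m)" for n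
    using Suc ideal_iso_trans by blast
  then have "ideal_iso (\<Union>n. A (s @ [n])) (H_ideal A \<J> (fin_ord (Suc m)) s) (T (Suc m)) (\<K> (Suc m))"
    unfolding H T \<K> by (intro ideal_iso_ideal_sum cells disj) (auto simp: H_ideal_def)
  then show ?case by (simp only: cells(2))
qed

section \<open>Iterated products\<close>

lemma Cons_image_tuples: "(\<Union>n. (#) n ` tuples m) = tuples (Suc m)"
  by (force simp: tuples_def length_Suc_conv image_iff)

lemma iter_prod_subset_Pow: "\<K> \<subseteq> Pow UNIV \<Longrightarrow> iter_prod \<J> m \<K> \<subseteq> Pow (tuples (Suc m))"
  by (cases m) (fastforce simp: tuples_def ideal_prod_def)+

lemma mem_iter_prod_0: "X \<in> iter_prod \<J> 0 \<K> \<longleftrightarrow> X \<subseteq> tuples 1 \<and> {n. [n] \<in> X} \<in> \<K>"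
proof -
  have "X = (\<lambda>n. [n]) ` {n. [n] \<in> X}" if "X \<subseteq> tuples 1"
    using that by (force simp: tuples_def length_Suc_conv)
  then show ?thesis by (auto simp: tuples_def image_iff)
qed

lemma mem_iter_prod_Suc:
  "X \<in> iter_prod \<J> (Suc m) \<K> \<longleftrightarrow>
    X \<subseteq> tuples (Suc (Suc m)) \<and> {n. {xs. n # xs \<in> X} \<notin> iter_prod \<J> m \<K>} \<in> \<J>"
proof -
  let ?c = "\<lambda>(n, xs). n # xs :: nat list" and ?T = "tuples (Suc m)"
  have inj: "inj ?c" by (auto simp: inj_def)
  have "X \<in> (`) ?c ` \<C> \<longleftrightarrow> X \<subseteq> tuples (Suc (Suc m)) \<and> ?c -` X \<in> \<C>" if "\<C> \<subseteq> Pow (UNIV \<times> ?T)" for \<C>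
  proof
    assume "X \<in> (`) ?c ` \<C>"
    then show "X \<subseteq> tuples (Suc (Suc m)) \<and> ?c -` X \<in> \<C>"
      using that inj by (fastforce simp: inj_vimage_image_eq tuples_def)
  next
    assume R: "X \<subseteq> tuples (Suc (Suc m)) \<and> ?c -` X \<in> \<C>"
    then have "X \<subseteq> range ?c"
      by (force simp: tuples_def length_Suc_conv)
    then have "X = ?c ` (?c -` X)" by blast
    then show "X \<in> (`) ?c ` \<C>" using R by blast
  qed
  from this[of "ideal_prod UNIV ?T \<J> (iter_prod \<J> m \<K>)"]
  have "X \<in> iter_prod \<J> (Suc m) \<K> \<longleftrightarrow> X \<subseteq> tuples (Suc (Suc m))
      \<and> ?c -` X \<in> ideal_prod UNIV ?T \<J> (iter_prod \<J> m \<K>)"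
    by (auto simp: ideal_prod_def)
  moreover have "{xs \<in> ?T. n # xs \<in> X} = {xs. n # xs \<in> X}" "?c -` X \<subseteq> UNIV \<times> ?T"
    if "X \<subseteq> tuples (Suc (Suc m))" for n
    using that by (auto simp: tuples_def)
  ultimately show ?thesis
    by (auto simp: ideal_prod_def)
qed

text \<open>
  Taking the indices of large sections fixes \<open>{}\<close>, is monotone and is subadditive for unions; such maps
  pull ideals back to ideals, which makes products inherit the ideal axioms.
\<close>

lemma ideal_on_preimage:
  assumes \<J>: "ideal_on R \<J>" and empty: "\<phi> {} = {}"
    and mono: "\<And>X Y. Y \<subseteq> X \<Longrightarrow> \<phi> Y \<subseteq> \<phi> X"
    and union: "\<And>X Y. \<phi> (X \<union> Y) \<subseteq> \<phi> X \<union> \<phi> Y"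
  shows "ideal_on S {X. X \<subseteq> S \<and> \<phi> X \<in> \<J>}"
proof -
  have down: "M \<in> \<J>" if "N \<in> \<J>" "M \<subseteq> N" for M N
    using \<J> that unfolding ideal_on_def by blast
  have "\<phi> (X \<union> Y) \<in> \<J>" if "\<phi> X \<in> \<J>" "\<phi> Y \<in> \<J>" for X Y
  proof (rule down[OF _ union])
    show "\<phi> X \<union> \<phi> Y \<in> \<J>" using \<J> that unfolding ideal_on_def by blast
  qed
  moreover have "\<phi> {} \<in> \<J>"
    using \<J> unfolding empty ideal_on_def by blast
  moreover have "\<phi> Y \<in> \<J>" if "\<phi> X \<in> \<J>" "Y \<subseteq> X" for X Y
    using down[OF that(1) mono[OF that(2)]] .
  ultimately show ?thesis unfolding ideal_on_def by blast
qed

lemma ideal_on_iter_prod: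
  assumes \<J>: "ideal_on UNIV \<J>" and \<K>: "ideal_on UNIV \<K>"
  shows "ideal_on (tuples (Suc m)) (iter_prod \<J> m \<K>)"
proof (induction m)
  case 0
  have "ideal_on (tuples 1) {X. X \<subseteq> tuples 1 \<and> {n. [n] \<in> X} \<in> \<K>}"
    by (rule ideal_on_preimage[OF \<K>]) auto
  moreover have "iter_prod \<J> 0 \<K> = {X. X \<subseteq> tuples 1 \<and> {n. [n] \<in> X} \<in> \<K>}"
    using mem_iter_prod_0 by blast
  ultimately show ?case by simp
next
  case (Suc m)
  have down: "Y \<in> iter_prod \<J> m \<K>" if "X \<in> iter_prod \<J> m \<K>" "Y \<subseteq> X" for X Y
    using Suc that unfolding ideal_on_def by blast
  have Un: "X \<union> Y \<in> iter_prod \<J> m \<K>" if "X \<in> iter_prod \<J> m \<K>" "Y \<in> iter_prod \<J> m \<K>" for X Y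
    using Suc that unfolding ideal_on_def by blast
  have "ideal_on (tuples (Suc (Suc m)))
      {X. X \<subseteq> tuples (Suc (Suc m)) \<and> {n. {xs. n # xs \<in> X} \<notin> iter_prod \<J> m \<K>} \<in> \<J>}"
  proof (rule ideal_on_preimage[OF \<J>])
    show "{n. {xs. n # xs \<in> {}} \<notin> iter_prod \<J> m \<K>} = {}"
      using Suc unfolding ideal_on_def by simp
    show "{n. {xs. n # xs \<in> Y} \<notin> iter_prod \<J> m \<K>} \<subseteq> {n. {xs. n # xs \<in> X} \<notin> iter_prod \<J> m \<K>}"
      if "Y \<subseteq> X" for X Y
    proof -
      have "{xs. n # xs \<in> Y} \<subseteq> {xs. n # xs \<in> X}" for n
        using that by blast
      then show ?thesis using down by blast
    qed
    show "{n. {xs. n # xs \<in> X \<union> Y} \<notin> iter_prod \<J> m \<K>}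
        \<subseteq> {n. {xs. n # xs \<in> X} \<notin> iter_prod \<J> m \<K>} \<union> {n. {xs. n # xs \<in> Y} \<notin> iter_prod \<J> m \<K>}" for X Y
    proof -
      have "{xs. n # xs \<in> X \<union> Y} = {xs. n # xs \<in> X} \<union> {xs. n # xs \<in> Y}" for n
        by blast
      then show ?thesis using Un by auto
    qed
  qed
  moreover have "iter_prod \<J> (Suc m) \<K> = {X. X \<subseteq> tuples (Suc (Suc m)) \<and>
      {n. {xs. n # xs \<in> X} \<notin> iter_prod \<J> m \<K>} \<in> \<J>}"
    using mem_iter_prod_Suc by blast
  ultimately show ?case by (simp only:)
qed

text \<open>
  Associativity of the product: \<open>\<J>\<^bsup>\<otimes>(r+k+2)\<^esup>\<close> is the sum over \<open>\<J>\<^bsup>\<otimes>(r+1)\<^esup>\<close> of copies of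
  \<open>\<J>\<^bsup>\<otimes>(k+1)\<^esup>\<close>. The indices carry an off-by-one because \<open>iter_prod \<J> r \<J>\<close> has \<open>r + 1\<close>
  factors.
\<close>

lemma mem_iter_prod_append:
  "X \<in> iter_prod \<J> (Suc r + k) \<J> \<longleftrightarrow> X \<subseteq> tuples (Suc (Suc r + k)) \<and>
    {xs \<in> tuples (Suc r). {ys. xs @ ys \<in> X} \<notin> iter_prod \<J> k \<J>} \<in> iter_prod \<J> r \<J>"
proof (induction r arbitrary: X)
  case 0
  have "{n. [n] \<in> {xs \<in> tuples 1. {ys. xs @ ys \<in> X} \<notin> iter_prod \<J> k \<J>}}
      = {n. {ys. n # ys \<in> X} \<notin> iter_prod \<J> k \<J>}"
    by (simp add: tuples_def)
  then show ?case
    by (simp add: mem_iter_prod_Suc mem_iter_prod_0 del: iter_prod.simps)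
next
  case (Suc r)
  let ?P = "\<lambda>X. {xs \<in> tuples (Suc r). {ys. xs @ ys \<in> X} \<notin> iter_prod \<J> k \<J>}"
  let ?Q = "{xs \<in> tuples (Suc (Suc r)). {ys. xs @ ys \<in> X} \<notin> iter_prod \<J> k \<J>}"
  show ?case
  proof (cases "X \<subseteq> tuples (Suc (Suc (Suc r) + k))")
    case True
    then have "{xs. n # xs \<in> X} \<subseteq> tuples (Suc (Suc r + k))" for n
      by (auto simp: tuples_def)
    then have "{xs. n # xs \<in> X} \<in> iter_prod \<J> (Suc r + k) \<J>
        \<longleftrightarrow> ?P {xs. n # xs \<in> X} \<in> iter_prod \<J> r \<J>" for n
      using Suc.IH by blast
    moreover have "?P {xs. n # xs \<in> X} = {xs. n # xs \<in> ?Q}" for n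
      by (simp add: tuples_def)
    ultimately have "{n. {xs. n # xs \<in> X} \<notin> iter_prod \<J> (Suc r + k) \<J>}
        = {n. {xs. n # xs \<in> ?Q} \<notin> iter_prod \<J> r \<J>}"
      by simp
    then show ?thesis
      using True mem_iter_prod_Suc[of X \<J> "Suc r + k" \<J>] mem_iter_prod_Suc[of ?Q \<J> r \<J>] by auto
  next
    case False
    then show ?thesis using mem_iter_prod_Suc[of X \<J> "Suc r + k" \<J>] by simp
  qed
qed

section \<open>The ideals of finite rank\<close>

lemma ideal_on_Fin: "ideal_on UNIV Fin"
  by (auto simp: ideal_on_def Fin_def intro: finite_subset)

lemma ideal_iso_Fin_iter_prod_0: "ideal_iso UNIV Fin (tuples 1) (iter_prod \<J> 0 Fin)"
proof -
  have "bij_betw (\<lambda>n. [n]) UNIV (tuples 1)"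
    by (auto simp: bij_betw_def inj_on_def tuples_def length_Suc_conv)
  then show ?thesis by (auto simp: ideal_iso_def)
qed

lemma H_ideal_iso_iter_prod:
  assumes A: "tree_partition A" and \<J>: "ideal_on UNIV \<J>"
  shows "ideal_iso (A s) (H_ideal A \<J> (fin_ord m) s) (tuples (m + 1)) (iter_prod \<J> m Fin)"
proof (rule H_ideal_iso_iterated_sum[OF A \<J>, where g = "(#)" and T = "\<lambda>m. tuples (m + 1)"
      and \<K> = "\<lambda>m. iter_prod \<J> m Fin"])
  show "iter_prod \<J> (Suc m) Fin
      = ideal_sum \<J> (\<lambda>n. (#) n ` tuples (m + 1)) (\<lambda>n. (`) ((#) n) ` iter_prod \<J> m Fin)" for m
  proof -
    have "{xs \<in> tuples (Suc m). n # xs \<in> X} = {xs. n # xs \<in> X}"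
      if "X \<subseteq> tuples (Suc (Suc m))" for X n
      using that by (auto simp: tuples_def)
    then show ?thesis
      by (subst ideal_sum_copies)
        (auto simp: mem_iter_prod_Suc Cons_image_tuples iter_prod_subset_Pow
          simp del: iter_prod.simps cong: conj_cong)
  qed
qed (auto simp: Cons_image_tuples ideal_iso_Fin_iter_prod_0[simplified] disjoint_family_on_def)

text \<open>
  Through \<open>e\<close> each \<open>n\<close> names an \<open>r\<close>-tuple, and the summand with index \<open>n\<close> is copied by
  prepending this tuple. By associativity, every step of the recursion adds \<open>r\<close> factors \<open>Fin\<close>.
\<close>

lemma H_ideal_Fin_pow_iso:
  assumes A: "tree_partition A" and r: "r \<ge> 1" and e: "bij_betw e (tuples r) UNIV"
  shows "ideal_iso (A s) (H_ideal A ((`) e ` Fin_pow r) (fin_ord m) s)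
    (tuples (r * m + 1)) (Fin_pow (r * m + 1))"
proof -
  obtain q where q: "r = Suc q" using r by (cases r) auto
  define \<J> where "\<J> = (`) e ` Fin_pow r"
  define d where "d = inv_into (tuples r) e"
  have d: "bij_betw d UNIV (tuples r)"
    unfolding d_def using e by (rule bij_betw_inv_into)
  have ed: "e (d n) = n" for n
    using e by (simp add: d_def bij_betw_inv_into_right)
  have de: "d (e xs) = xs" if "xs \<in> tuples r" for xs
    using e that by (simp add: d_def bij_betw_inv_into_left)
  have len: "length (d n) = r" for n
    using d by (auto simp: bij_betw_def tuples_def)
  have Fin_pow: "ideal_on (tuples r) (Fin_pow r)"
    using ideal_on_iter_prod[OF ideal_on_Fin ideal_on_Fin] by (simp add: Fin_pow_def q)
  have mem_\<J>: "M \<in> \<J> \<longleftrightarrow> d ` M \<in> Fin_pow r" for M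
  proof -
    have "d ` e ` N = N" if "N \<in> Fin_pow r" for N
      using that Fin_pow de unfolding ideal_on_def by (force simp: image_iff)
    then have "d ` M \<in> Fin_pow r" if "M \<in> \<J>"
      using that unfolding \<J>_def by auto
    moreover have "M \<in> \<J>" if "d ` M \<in> Fin_pow r"
    proof -
      have "M = e ` d ` M" by (simp add: image_image ed)
      then show ?thesis using that unfolding \<J>_def by (rule image_eqI)
    qed
    ultimately show ?thesis by blast
  qed
  have \<J>: "ideal_on UNIV \<J>"
  proof -
    have "ideal_on UNIV {M. M \<subseteq> UNIV \<and> d ` M \<in> Fin_pow r}"
      by (rule ideal_on_preimage[OF Fin_pow]) auto
    moreover have "\<J> = {M. M \<subseteq> UNIV \<and> d ` M \<in> Fin_pow r}"
      using mem_\<J> by blast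
    ultimately show ?thesis by (simp only:)
  qed
  have blocks: "(\<Union>n. (@) (d n) ` tuples k) = tuples (r + k)" for k
  proof -
    have "xs \<in> (\<Union>n. (@) (d n) ` tuples k)" if "length xs = r + k" for xs
    proof -
      have "d (e (take r xs)) @ drop r xs = xs"
        using that by (simp add: de tuples_def)
      moreover have "drop r xs \<in> tuples k"
        using that by (simp add: tuples_def)
      ultimately show ?thesis by (metis UN_iff UNIV_I imageI)
    qed
    then show ?thesis by (auto simp: tuples_def len)
  qed
  have "ideal_iso (A s) (H_ideal A \<J> (fin_ord m) s) (tuples (r * m + 1)) (iter_prod Fin (r * m) Fin)"
  proof (rule H_ideal_iso_iterated_sum[OF A \<J>, where g = "\<lambda>n. (@) (d n)"
        and T = "\<lambda>m. tuples (r * m + 1)" and \<K> = "\<lambda>m. iter_prod Fin (r * m) Fin"])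
    show "disjoint_family (\<lambda>n. (@) (d n) ` tuples (r * m + 1))" for m
    proof -
      have "n = k" if "d n @ xs = d k @ ys" for n k xs ys
        using that len ed by (metis append_eq_append_conv)
      then show ?thesis unfolding disjoint_family_on_def by blast
    qed
    show "iter_prod Fin (r * Suc m) Fin = ideal_sum \<J> (\<lambda>n. (@) (d n) ` tuples (r * m + 1))
        (\<lambda>n. (`) ((@) (d n)) ` iter_prod Fin (r * m) Fin)" for m
    proof -
      let ?K = "iter_prod Fin (r * m) Fin"
      have append: "X \<in> iter_prod Fin (r + r * m) Fin \<longleftrightarrow> X \<subseteq> tuples (r + (r * m + 1)) \<and>
          {xs \<in> tuples r. {ys. xs @ ys \<in> X} \<notin> ?K} \<in> Fin_pow r" for X
        using mem_iter_prod_append[of X Fin q "r * m"]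
        unfolding Fin_pow_def q by (simp del: iter_prod.simps)
      have named: "d ` {n. {ys \<in> tuples (r * m + 1). d n @ ys \<in> X} \<notin> ?K}
          = {xs \<in> tuples r. {ys. xs @ ys \<in> X} \<notin> ?K}" if "X \<subseteq> tuples (r + (r * m + 1))" for X
      proof -
        have "{ys \<in> tuples (r * m + 1). d n @ ys \<in> X} = {ys. d n @ ys \<in> X}" for n
          using that by (auto simp: tuples_def len)
        then show ?thesis
          unfolding bij_betw_imp_surj_on[OF d, symmetric] by auto
      qed
      have "ideal_sum \<J> (\<lambda>n. (@) (d n) ` tuples (r * m + 1)) (\<lambda>n. (`) ((@) (d n)) ` ?K)
          = {X. X \<subseteq> tuples (r + (r * m + 1)) \<and>
              {n. {ys \<in> tuples (r * m + 1). d n @ ys \<in> X} \<notin> ?K} \<in> \<J>}"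
        using ideal_sum_copies[of "\<lambda>n. (@) (d n)" "tuples (r * m + 1)" ?K \<J>]
          iter_prod_subset_Pow[of Fin Fin "r * m"]
        by (simp add: blocks inj_on_def del: iter_prod.simps)
      also have "\<dots> = iter_prod Fin (r + r * m) Fin"
        using append named by (auto simp: mem_\<J> simp del: iter_prod.simps)
      finally show ?thesis by simp
    qed
    show "tuples (r * Suc m + 1) = (\<Union>n. (@) (d n) ` tuples (r * m + 1))" for m
      by (simp add: blocks)
  qed (auto simp: inj_on_def ideal_iso_Fin_iter_prod_0[simplified])
  then show ?thesis by (simp add: \<J>_def Fin_pow_def)
qed

theorem theorem3p5:
  fixes A :: "nat list \<Rightarrow> nat set" and \<J> :: "nat set set"
  assumes "tree_partition A"
    and "proper_ideal_on UNIV \<J>" and "Fin \<subseteq> \<J>"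
  shows "(\<forall>s \<alpha>. H_ideal A \<J> (osuc \<alpha>) s =
            {X. X \<subseteq> A s \<and> {n. X \<inter> A (s @ [n]) \<notin> H_ideal A \<J> \<alpha> (s @ [n])} \<in> \<J>})
       \<and> (\<forall>s \<delta>. is_limit \<delta> \<longrightarrow> H_ideal A \<J> \<delta> s = (\<Union>\<beta>\<in>{..<\<delta>}. H_ideal A \<J> \<beta> s))
       \<and> (\<forall>m. ideal_iso UNIV (H_ideal A \<J> (fin_ord m) []) (tuples (m + 1)) (iter_prod \<J> m Fin))
       \<and> (\<forall>m r e. r \<ge> 1 \<longrightarrow> bij_betw e (tuples r) UNIV \<longrightarrow>
            ideal_iso UNIV (H_ideal A ((`) e ` Fin_pow r) (fin_ord m) [])
              (tuples (r * m + 1)) (Fin_pow (r * m + 1)))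
       \<and> (\<forall>n. ideal_iso UNIV (H_ideal A Fin (fin_ord n) []) (tuples (n + 1)) (Fin_pow (n + 1)))"
proof -
  have root: "A [] = UNIV"
    using assms(1) by (simp add: tree_partition_def)
  have \<J>: "ideal_on UNIV \<J>"
    using assms(2) by (simp add: proper_ideal_on_def)
  have pow: "Fin_pow (n + 1) = iter_prod Fin n Fin" for n
    by (simp add: Fin_pow_def)
  show ?thesis
    by (intro conjI allI impI H_ideal_osuc[OF assms(1) \<J>] H_ideal_limit
        H_ideal_iso_iter_prod[OF assms(1) \<J>, of "[]", unfolded root]
        H_ideal_Fin_pow_iso[OF assms(1), of _ _ "[]", unfolded root]
        H_ideal_iso_iter_prod[OF assms(1) ideal_on_Fin, of "[]", unfolded root, folded pow])
qed

end
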